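(* Let $\gamma$ be a modulus function satisfying Condition (A). Then $\tau_\gamma=\tau_d$.
   Context: $|\cdot|$ denotes Lebesgue measure on $\mathbb{R}$, $\mathcal{L}$ the family of Lebesgue measurable subsets of $\mathbb{R}$, and $A^c=\mathbb{R}\setminus A$. A modulus function is a function $\gamma:[0,\infty)\to[0,\infty)$ such that (i) $\gamma(a)=0\Leftrightarrow a=0$; (ii) $\gamma(a+b)\le\gamma(a)+\gamma(b)$ for all $a,b\ge 0$; (iii) $\gamma$ is right-continuous at $0$; (iv) $\gamma$ is increasing (in the weak sense: $a\le b$ implies $\gamma(a)\le\gamma(b)$). Condition (A): for every $\varepsilon>0$ there exist $c_\varepsilon\in(0,1)$ and $\delta_\varepsilon>0$ such that $\frac{\gamma(c_\varepsilon t)}{\gamma(t)}<\varepsilon$ for all $0<t<\delta_\varepsilon$. For $A\in\mathcal{L}$, $\mathcal{D}_\gamma(A)$ is the set of all $x\in\mathbb{R}$ with $\lim_{\alpha\to 0^+}\frac{\gamma(|(x-\alpha,x+\alpha)\cap A^c|)}{\gamma(2\alpha)}=0$, and $\Phi(A)$ is the set of all $x\in\mathbb{R}$ with $\lim_{\alpha\to 0^+}\frac{|A\cap(x-\alpha,x+\alpha)|}{2\alpha}=1$. The modulus density topology is $\tau_\gamma=\{A\in\mathcal{L}:A\subset\mathcal{D}_\gamma(A)\}$ and the Lebesgue density topology is $\tau_d=\{A\in\mathcal{L}:A\subset\Phi(A)\}$. *)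

theory Defs
  imports "HOL-Analysis.Analysis"
begin

(* A function from [0,\<infinity>) to [0,\<infinity>) is rendered as a total function on the reals of
   which only the values at nonnegative arguments are constrained or used. *)
definition modulus_function :: "(real \<Rightarrow> real) \<Rightarrow> bool" where
  "modulus_function \<gamma> \<longleftrightarrow>
     \<gamma> ` {0..} \<subseteq> {0..} \<and>
     (\<forall>a\<ge>0. \<gamma> a = 0 \<longleftrightarrow> a = 0) \<and>
     (\<forall>a\<ge>0. \<forall>b\<ge>0. \<gamma> (a + b) \<le> \<gamma> a + \<gamma> b) \<and>
     continuous (at_right 0) \<gamma> \<and>
     mono_on {0..} \<gamma>"

definition condition_A :: "(real \<Rightarrow> real) \<Rightarrow> bool" where
  "condition_A \<gamma> \<longleftrightarrow>
     (\<forall>\<epsilon>>0. \<exists>c\<in>{0<..<1}. \<exists>\<delta>>0. \<forall>t. 0 < t \<and> t < \<delta> \<longrightarrow> \<gamma> (c * t) / \<gamma> t < \<epsilon>)"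

definition modulus_density_points :: "(real \<Rightarrow> real) \<Rightarrow> real set \<Rightarrow> real set" where
  "modulus_density_points \<gamma> A =
     {x. ((\<lambda>\<alpha>. \<gamma> (measure lebesgue ({x - \<alpha><..<x + \<alpha>} \<inter> - A)) / \<gamma> (2 * \<alpha>)) \<longlongrightarrow> 0) (at_right 0)}"

definition lebesgue_density_points :: "real set \<Rightarrow> real set" where
  "lebesgue_density_points A =
     {x. ((\<lambda>\<alpha>. measure lebesgue (A \<inter> {x - \<alpha><..<x + \<alpha>}) / (2 * \<alpha>)) \<longlongrightarrow> 1) (at_right 0)}"

(* Both topologies are given as their families of open sets. *)
definition modulus_density_topology :: "(real \<Rightarrow> real) \<Rightarrow> real set set" where
  "modulus_density_topology \<gamma> = {A \<in> sets lebesgue. A \<subseteq> modulus_density_points \<gamma> A}"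

definition lebesgue_density_topology :: "real set set" where
  "lebesgue_density_topology = {A \<in> sets lebesgue. A \<subseteq> lebesgue_density_points A}"

end

theory Submission
  imports Defs
begin

text \<open>
  For measurable \<open>A\<close> the two notions of density point coincide, so the two topologies do.
  A point \<open>x\<close> is a Lebesgue density point of \<open>A\<close> iff \<open>m(\<alpha>) / (2 * \<alpha>)\<close> tends to \<open>0\<close>, where \<open>m(\<alpha>)\<close> is
  the measure of the part of the interval \<open>(x - \<alpha>, x + \<alpha>)\<close> outside \<open>A\<close>; it is a modulus density
  point iff \<open>\<gamma> (m(\<alpha>)) / \<gamma> (2 * \<alpha>)\<close> tends to \<open>0\<close>. That these two limits are
  equivalent is a fact about \<open>\<gamma>\<close> alone, valid for any nonnegative \<open>m\<close>.

  Condition (A) says that scaling the argument of \<open>\<gamma>\<close> by a suitable fixed \<open>c\<close> makes \<open>\<gamma>\<close> relatively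
  small, so \<open>m(\<alpha>) \<le> c * (2 * \<alpha>)\<close> together with monotonicity bounds the modulus ratio
  (\<open>modulus_ratio_tendsto_0\<close>). Conversely subadditivity gives \<open>\<gamma> (n * t) \<le> n * \<gamma> t\<close>, so a modulus
  ratio below \<open>1 / n\<close> forces \<open>n * m(\<alpha>) < 2 * \<alpha>\<close> (\<open>ratio_tendsto_0_of_modulus\<close>).
\<close>

lemma modulus_function_nonneg:
  assumes "modulus_function \<gamma>" "0 \<le> a"
  shows "0 \<le> \<gamma> a"
  using assms by (auto simp: modulus_function_def)

lemma modulus_function_pos:
  assumes "modulus_function \<gamma>" "0 < a"
  shows "0 < \<gamma> a"
  using assms modulus_function_nonneg[of \<gamma> a]
  by (auto simp: modulus_function_def order.order_iff_strict)

lemma modulus_function_mono: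
  assumes "modulus_function \<gamma>" "0 \<le> a" "a \<le> b"
  shows "\<gamma> a \<le> \<gamma> b"
  using assms by (auto simp: modulus_function_def mono_on_def)

lemma modulus_function_of_nat_mult_le:
  assumes "modulus_function \<gamma>" "0 \<le> a"
  shows "\<gamma> (real n * a) \<le> real n * \<gamma> a"
proof (induction n)
  case 0
  have "\<gamma> 0 = 0" using assms(1) unfolding modulus_function_def by blast
  then show ?case by simp
next
  case (Suc n)
  have "\<gamma> (real n * a + a) \<le> \<gamma> (real n * a) + \<gamma> a"
    using assms by (simp add: modulus_function_def)
  with Suc show ?case by (simp add: algebra_simps)
qed

text \<open>Condition (A) turns the linear smallness \<open>m \<le> c * s\<close> into smallness of \<open>\<gamma> m\<close> relative to
  \<open>\<gamma> s\<close>; it speaks of small arguments only, hence the assumption that \<open>s\<close> tends to \<open>0\<close>.\<close>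

lemma modulus_ratio_tendsto_0:
  fixes m s :: "'a \<Rightarrow> real"
  assumes \<gamma>: "modulus_function \<gamma>" and A: "condition_A \<gamma>"
    and m: "\<forall>\<^sub>F a in F. 0 \<le> m a" and s: "\<forall>\<^sub>F a in F. 0 < s a" and s0: "(s \<longlongrightarrow> 0) F"
    and ratio: "((\<lambda>a. m a / s a) \<longlongrightarrow> 0) F"
  shows "((\<lambda>a. \<gamma> (m a) / \<gamma> (s a)) \<longlongrightarrow> 0) F"
proof (rule tendstoI)
  fix \<epsilon> :: real assume "0 < \<epsilon>"
  then obtain c \<delta> where "0 < c" "0 < \<delta>"
    and c: "\<And>t. 0 < t \<Longrightarrow> t < \<delta> \<Longrightarrow> \<gamma> (c * t) / \<gamma> t < \<epsilon>"
    using A unfolding condition_A_def by fastforce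
  have "\<forall>\<^sub>F a in F. m a / s a < c" "\<forall>\<^sub>F a in F. s a < \<delta>"
    using order_tendstoD(2)[OF ratio \<open>0 < c\<close>] order_tendstoD(2)[OF s0 \<open>0 < \<delta>\<close>] .
  with m s show "\<forall>\<^sub>F a in F. dist (\<gamma> (m a) / \<gamma> (s a)) 0 < \<epsilon>"
  proof eventually_elim
    case (elim a)
    have "\<gamma> (m a) \<le> \<gamma> (c * s a)"
      using elim by (intro modulus_function_mono[OF \<gamma>]) (auto simp: field_simps)
    then have "\<gamma> (m a) / \<gamma> (s a) \<le> \<gamma> (c * s a) / \<gamma> (s a)"
      using modulus_function_pos[OF \<gamma>, of "s a"] elim by (simp add: divide_right_mono)
    also have "\<dots> < \<epsilon>" using c elim by blast
    finally show ?case
      using modulus_function_nonneg[OF \<gamma>, of "m a"] modulus_function_pos[OF \<gamma>, of "s a"] elim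
      by simp
  qed
qed

text \<open>If \<open>s \<le> n * m\<close> then \<open>\<gamma> s \<le> n * \<gamma> m\<close>, so the modulus ratio cannot drop below \<open>1 / n\<close> unless the
  plain ratio does.\<close>

lemma ratio_tendsto_0_of_modulus:
  fixes m s :: "'a \<Rightarrow> real"
  assumes \<gamma>: "modulus_function \<gamma>"
    and m: "\<forall>\<^sub>F a in F. 0 \<le> m a" and s: "\<forall>\<^sub>F a in F. 0 < s a"
    and ratio: "((\<lambda>a. \<gamma> (m a) / \<gamma> (s a)) \<longlongrightarrow> 0) F"
  shows "((\<lambda>a. m a / s a) \<longlongrightarrow> 0) F"
proof (rule tendstoI)
  fix \<epsilon> :: real assume "0 < \<epsilon>"
  then obtain n where "n > 0" and n: "inverse (real n) < \<epsilon>"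
    using ex_inverse_of_nat_less by blast
  then have "\<forall>\<^sub>F a in F. \<gamma> (m a) / \<gamma> (s a) < inverse (real n)"
    by (intro order_tendstoD(2)[OF ratio]) simp
  with m s show "\<forall>\<^sub>F a in F. dist (m a / s a) 0 < \<epsilon>"
  proof eventually_elim
    case (elim a)
    have "real n * \<gamma> (m a) < \<gamma> (s a)"
      using elim modulus_function_pos[OF \<gamma>, of "s a"] \<open>n > 0\<close> by (simp add: field_simps)
    then have "\<gamma> (real n * m a) < \<gamma> (s a)"
      using modulus_function_of_nat_mult_le[OF \<gamma>, of "m a" n] elim by linarith
    then have "real n * m a < s a"
      using modulus_function_mono[OF \<gamma>, of "s a" "real n * m a"] elim by force
    then have "m a / s a < inverse (real n)"
      using elim \<open>n > 0\<close> by (simp add: field_simps)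
    with n elim show ?case by simp
  qed
qed

lemma lebesgue_density_point_iff_complement:
  assumes A: "A \<in> sets lebesgue"
  shows "x \<in> lebesgue_density_points A \<longleftrightarrow>
    ((\<lambda>\<alpha>. measure lebesgue ({x - \<alpha><..<x + \<alpha>} \<inter> - A) / (2 * \<alpha>)) \<longlongrightarrow> 0) (at_right 0)"
    (is "_ \<longleftrightarrow> (?g \<longlongrightarrow> 0) _")
proof -
  let ?f = "\<lambda>\<alpha>. measure lebesgue (A \<inter> {x - \<alpha><..<x + \<alpha>}) / (2 * \<alpha>)"
  have "?f \<alpha> = 1 - ?g \<alpha>" if "0 < \<alpha>" for \<alpha>
  proof -
    let ?I = "{x - \<alpha><..<x + \<alpha>}"
    have fin: "?I \<in> lmeasurable"
      using lmeasurable_box[of "x - \<alpha>" "x + \<alpha>"] by (simp add: box_real)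
    have "measure lebesgue (?I - A \<inter> ?I) = measure lebesgue ?I - measure lebesgue (A \<inter> ?I)"
      using A fin by (intro measurable_measure_Diff) auto
    moreover have "?I - A \<inter> ?I = ?I \<inter> - A" by blast
    moreover have "measure lebesgue ?I = 2 * \<alpha>" using that by simp
    ultimately show ?thesis using that by (simp add: field_simps)
  qed
  then have "\<forall>\<^sub>F \<alpha> in at_right 0. ?f \<alpha> = 1 - ?g \<alpha>"
    by (auto simp: eventually_at_right_less intro: eventually_at_rightI[of 0 1])
  then have "x \<in> lebesgue_density_points A \<longleftrightarrow> ((\<lambda>\<alpha>. 1 - ?g \<alpha>) \<longlongrightarrow> 1) (at_right 0)"
    unfolding lebesgue_density_points_def by (simp cong: tendsto_cong)
  also have "\<dots> \<longleftrightarrow> (?g \<longlongrightarrow> 0) (at_right 0)"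
    using tendsto_diff[OF tendsto_const[of 1], of "\<lambda>\<alpha>. 1 - ?g \<alpha>" 1 "at_right 0"]
      tendsto_diff[OF tendsto_const[of 1], of ?g 0 "at_right 0"] by auto
  finally show ?thesis .
qed

lemma modulus_density_points_eq_lebesgue:
  assumes \<gamma>: "modulus_function \<gamma>" and A: "condition_A \<gamma>" and "B \<in> sets lebesgue"
  shows "modulus_density_points \<gamma> B = lebesgue_density_points B"
proof (rule set_eqI)
  fix x
  let ?m = "\<lambda>\<alpha>. measure lebesgue ({x - \<alpha><..<x + \<alpha>} \<inter> - B)"
  have m: "\<forall>\<^sub>F \<alpha> in at_right 0. 0 \<le> ?m \<alpha>" by simp
  have s: "\<forall>\<^sub>F \<alpha> in at_right 0. 0 < 2 * (\<alpha>::real)"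
    by (simp add: eventually_at_right_less)
  have s0: "((\<lambda>\<alpha>::real. 2 * \<alpha>) \<longlongrightarrow> 0) (at_right 0)"
    by (auto intro!: tendsto_eq_intros)
  show "x \<in> modulus_density_points \<gamma> B \<longleftrightarrow> x \<in> lebesgue_density_points B"
    unfolding lebesgue_density_point_iff_complement[OF \<open>B \<in> sets lebesgue\<close>]
    using modulus_ratio_tendsto_0[OF \<gamma> A m s s0] ratio_tendsto_0_of_modulus[OF \<gamma> m s]
    by (auto simp: modulus_density_points_def)
qed

theorem theorem10:
  fixes \<gamma> :: "real \<Rightarrow> real"
  assumes "modulus_function \<gamma>"
    and "condition_A \<gamma>"
  shows "modulus_density_topology \<gamma> = lebesgue_density_topology"
  using modulus_density_points_eq_lebesgue[OF assms]
  by (auto simp: modulus_density_topology_def lebesgue_density_topology_def)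

end
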